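(* Let $m\in\mathbb{N}=\{1,2,3,\dots\}$, $h\in\mathbb{Z}$ and $x\in\mathbb{Z}_p$. Then $$E_{m,q^{-1}}^{(h,1)}(1-x)=(-1)^mq^{m+h-1}E_{m,q}^{(h,1)}(x).$$ In particular, $$E_{m,q^{-1}}^{(h,1)}(0)=(-1)^mq^{m+h-1}E_{m,q}^{(h,1)}(1)=(-1)^{m-1}q^{m-1}E_{m,q}^{(h,1)},$$ where $E_{m,q}^{(h,1)}=E_{m,q}^{(h,1)}(0)$.
   Context: Let $p$ be an odd prime, $\mathbb{C}_p$ the completion of the algebraic closure of $\mathbb{Q}_p$, with $|p|_p=p^{-1}$. Let $q\in\mathbb{C}_p$ with $|1-q|_p<p^{-1/(p-1)}$ (then $q^{-1}$ satisfies the same condition). For $Q\in\{q,q^{-1}\}$ and $x\in\mathbb{Z}_p$ put $Q^x=\exp(x\log Q)$, $[x]_Q=\frac{1-Q^x}{1-Q}$, $[2]_Q=1+Q$. For $f:\mathbb{Z}_p\to\mathbb{C}_p$ (uniformly differentiable) define $$\int_{\mathbb{Z}_p}f(x)\,d\mu_{-Q}(x)=\lim_{N\to\infty}\frac{[2]_Q}{1+Q^{p^N}}\sum_{x=0}^{p^N-1}f(x)(-1)^xQ^x.$$ For $h\in\mathbb{Z}$, integers $m\ge0$ and $x\in\mathbb{Z}_p$ define $$E_{m,Q}^{(h,1)}(x)=\int_{\mathbb{Z}_p}[x+x_1]_Q^m\,Q^{(h-1)x_1}\,d\mu_{-Q}(x_1).$$ *)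

theory Defs
  imports "HOL-Analysis.Analysis" "HOL-Computational_Algebra.Polynomial"
begin

text \<open>
  Fields with a non-archimedean absolute value, as metric spaces. The library's \<open>norm\<close> is tied
  to real vector spaces, hence the separate name \<open>vabs\<close>. Definiteness and symmetry of \<open>vabs\<close> come
  from the metric.
\<close>

class ultrametric_field = field_char_0 + metric_space +
  fixes vabs :: "'a \<Rightarrow> real"
  assumes dist_vabs: "dist x y = vabs (x - y)"
    and vabs_mult: "vabs (x * y) = vabs x * vabs y"
    and vabs_add_le_max: "vabs (x + y) \<le> max (vabs x) (vabs y)"

text \<open>
  The type \<open>'a\<close> is \<open>\<complex>\<^sub>p\<close> if it is a completion of an algebraic closure of a completion of the
  rationals with respect to the absolute value normalised by \<open>|p| = 1/p\<close>. In a complete field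
  the closure of the rationals is their completion \<open>\<rat>\<^sub>p\<close>; the elements algebraic over it have to
  form an algebraically closed field which is dense. These conditions determine \<open>'a\<close> up to
  isometric isomorphism.
\<close>

definition padic_rationals :: "'a::ultrametric_field set" where
  "padic_rationals = closure \<rat>"

definition padic_integers :: "'a::ultrametric_field set" where
  "padic_integers = {x \<in> padic_rationals. vabs x \<le> 1}"

definition padic_algebraic :: "'a::ultrametric_field set" where
  "padic_algebraic =
    {z. \<exists>P. P \<noteq> 0 \<and> (\<forall>i. coeff P i \<in> padic_rationals) \<and> poly P z = 0}"

definition is_padic_complex_field :: "nat \<Rightarrow> 'a::ultrametric_field itself \<Rightarrow> bool" where
  "is_padic_complex_field p T \<longleftrightarrow>
     vabs (of_nat p :: 'a) = 1 / real p \<and>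
     complete (UNIV :: 'a set) \<and>
     (\<forall>P :: 'a poly. degree P > 0 \<and> (\<forall>i. coeff P i \<in> padic_algebraic) \<longrightarrow>
        (\<exists>z \<in> padic_algebraic. poly P z = 0)) \<and>
     closure (padic_algebraic :: 'a set) = UNIV"

definition padic_exp :: "'a::ultrametric_field \<Rightarrow> 'a" where
  "padic_exp z = (\<Sum>n. z ^ n / fact n)"

definition padic_log :: "'a::ultrametric_field \<Rightarrow> 'a" where
  "padic_log z = (\<Sum>n. (-1) ^ n * (z - 1) ^ Suc n / of_nat (Suc n))"

definition padic_pow :: "'a::ultrametric_field \<Rightarrow> 'a \<Rightarrow> 'a" where
  "padic_pow Q x = padic_exp (x * padic_log Q)"

text \<open>For \<open>Q = 1\<close> the quotient is read as its limit \<open>x\<close>.\<close>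

definition qnumber :: "'a::ultrametric_field \<Rightarrow> 'a \<Rightarrow> 'a" where
  "qnumber Q x = (if Q = 1 then x else (1 - padic_pow Q x) / (1 - Q))"

text \<open>
  The integral of \<open>f\<close> over \<open>\<int>\<^sub>p\<close> against \<open>\<mu>\<^bsub>-Q\<^esub>\<close>; the prefactor \<open>1 + Q\<close> is \<open>[2]\<^sub>Q\<close>.
\<close>

definition fermionic_integral ::
    "nat \<Rightarrow> 'a::ultrametric_field \<Rightarrow> ('a \<Rightarrow> 'a) \<Rightarrow> 'a" where
  "fermionic_integral p Q f =
     lim (\<lambda>N. (1 + Q) / (1 + Q ^ (p ^ N)) * (\<Sum>x<p ^ N. f (of_nat x) * (-1) ^ x * Q ^ x))"

text \<open>\<open>qeuler p h m Q x\<close> is \<open>E\<^bsub>m,Q\<^esub>\<^bsup>(h,1)\<^esup>(x)\<close>.\<close>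

definition qeuler :: "nat \<Rightarrow> int \<Rightarrow> nat \<Rightarrow> 'a::ultrametric_field \<Rightarrow> 'a \<Rightarrow> 'a" where
  "qeuler p h m Q x =
     fermionic_integral p Q (\<lambda>y. qnumber Q (x + y) ^ m * padic_pow Q (of_int (h - 1) * y))"

end

theory Submission
  imports Defs
begin

text \<open>
  Weighting the integrand by \<open>u\<^sup>y\<close> turns the integral against \<open>\<mu>\<^bsub>-u\<^esub>\<close> into \<open>(1 + u) / 2\<close> times one
  against \<open>\<mu>\<^bsub>-1\<^esub>\<close>, the limit of alternating sums over \<open>y < P = p\<^sup>N\<close>. A uniformly continuous
  integrand has \<open>P\<close> as an almost period, so for odd \<open>P\<close> the substitution \<open>y \<mapsto> P - 1 - y\<close> shows
  that this integral is invariant under \<open>y \<mapsto> -1 - y\<close>, and telescoping shows that it changes sign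
  under \<open>y \<mapsto> y + 1\<close> when the integrand vanishes at \<open>0\<close>. As the \<open>q\<inverse>\<close>-number of \<open>-t\<close> is \<open>-q [t]\<^sub>q\<close>,
  the first symmetry gives the reflection formula, and the second gives the last identity.

  The interpolation \<open>exp (x log u)\<close> of \<open>u\<^sup>x\<close> rests on \<open>exp (log u) = u\<close>. The limit
  \<open>log u = lim (u\<^sup>P - 1) / P\<close> shows that \<open>log\<close> is additive and that \<open>log (exp z) = z\<close>, and \<open>log\<close> is
  injective because \<open>|log u| = |u - 1|\<close>.
\<close>

section \<open>Ultrametric absolute values\<close>

lemma vabs_zero [simp]: "vabs (0::'a::ultrametric_field) = 0"
  by (metis diff_self dist_self dist_vabs)

lemma vabs_nonneg [simp]: "0 \<le> vabs (x::'a::ultrametric_field)"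
  by (metis diff_zero dist_vabs zero_le_dist)

lemma vabs_eq_0_iff [simp]: "vabs (x::'a::ultrametric_field) = 0 \<longleftrightarrow> x = 0"
  by (metis diff_zero dist_eq_0_iff dist_vabs)

lemma vabs_pos_iff [simp]: "0 < vabs (x::'a::ultrametric_field) \<longleftrightarrow> x \<noteq> 0"
  by (simp add: less_le)

lemma vabs_le_0_iff [simp]: "vabs (x::'a::ultrametric_field) \<le> 0 \<longleftrightarrow> x = 0"
  by (simp flip: not_less)

lemma vabs_one [simp]: "vabs (1::'a::ultrametric_field) = 1"
  using vabs_mult[of "1::'a" 1] by simp

lemma vabs_minus [simp]: "vabs (- x::'a::ultrametric_field) = vabs x"
  by (metis diff_0 diff_zero dist_commute dist_vabs)

lemma vabs_minus_commute: "vabs (x - y::'a::ultrametric_field) = vabs (y - x)"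
  by (metis dist_commute dist_vabs)

lemma vabs_diff_le_max: "vabs (x - y::'a::ultrametric_field) \<le> max (vabs x) (vabs y)"
  using vabs_add_le_max[of x "- y"] by simp

lemma vabs_power: "vabs (x ^ n::'a::ultrametric_field) = vabs x ^ n"
  by (induction n) (simp_all add: vabs_mult)

lemma vabs_inverse: "vabs (inverse x::'a::ultrametric_field) = inverse (vabs x)"
proof (cases "x = 0")
  case False
  then have "vabs x * vabs (inverse x) = 1"
    by (simp flip: vabs_mult)
  then show ?thesis
    by (simp add: inverse_unique)
qed simp

lemma vabs_divide: "vabs (x / y::'a::ultrametric_field) = vabs x / vabs y"
  by (simp add: divide_inverse vabs_mult vabs_inverse)

lemma vabs_sum_le:
  fixes f :: "'b \<Rightarrow> 'a::ultrametric_field"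
  assumes "\<And>i. i \<in> A \<Longrightarrow> vabs (f i) \<le> B" and "0 \<le> B"
  shows "vabs (sum f A) \<le> B"
  using assms(1)
proof (induction A rule: infinite_finite_induct)
  case (insert a A)
  then have "max (vabs (f a)) (vabs (sum f A)) \<le> B"
    by simp
  then show ?case
    using insert.hyps vabs_add_le_max[of "f a" "sum f A"] by simp linarith
qed (use assms(2) in auto)

lemma vabs_eq_of_diff_less:
  fixes x y :: "'a::ultrametric_field"
  assumes "vabs (x - y) < vabs y"
  shows "vabs x = vabs y"
  using vabs_add_le_max[of "x - y" y] vabs_diff_le_max[of x "x - y"] assms by simp

lemma vabs_of_nat_le_1: "vabs (of_nat n::'a::ultrametric_field) \<le> 1"
proof (induction n)
  case (Suc n)
  then show ?case
    using vabs_add_le_max[of 1 "of_nat n::'a"] by simp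
qed simp

lemma vabs_of_int_le_1: "vabs (of_int k::'a::ultrametric_field) \<le> 1"
  by (cases k rule: int_cases2) (simp_all add: vabs_of_nat_le_1)

lemma vabs_of_int_mult_le: "vabs (of_int k * x::'a::ultrametric_field) \<le> vabs x"
  by (simp add: vabs_mult mult_left_le_one_le vabs_of_int_le_1)

definition valuation_ring :: "'a::ultrametric_field set" where
  "valuation_ring = {x. vabs x \<le> 1}"

lemma valuation_ring_0 [simp]: "0 \<in> valuation_ring"
  by (simp add: valuation_ring_def)

lemma valuation_ring_1 [simp]: "1 \<in> valuation_ring"
  by (simp add: valuation_ring_def)

lemma valuation_ring_of_int [simp]: "of_int k \<in> valuation_ring"
  by (simp add: valuation_ring_def vabs_of_int_le_1)

lemma valuation_ring_of_nat [simp]: "of_nat n \<in> valuation_ring"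
  by (simp add: valuation_ring_def vabs_of_nat_le_1)

lemma valuation_ring_add: "x \<in> valuation_ring \<Longrightarrow> y \<in> valuation_ring \<Longrightarrow> x + y \<in> valuation_ring"
  using vabs_add_le_max[of x y] by (simp add: valuation_ring_def)

lemma valuation_ring_diff: "x \<in> valuation_ring \<Longrightarrow> y \<in> valuation_ring \<Longrightarrow> x - y \<in> valuation_ring"
  using vabs_diff_le_max[of x y] by (simp add: valuation_ring_def)

lemma valuation_ring_mult: "x \<in> valuation_ring \<Longrightarrow> y \<in> valuation_ring \<Longrightarrow> x * y \<in> valuation_ring"
  by (simp add: valuation_ring_def vabs_mult mult_le_one)

lemma valuation_ring_power: "x \<in> valuation_ring \<Longrightarrow> x ^ n \<in> valuation_ring"
  by (simp add: valuation_ring_def vabs_power power_le_one)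

lemma Ints_subset_valuation_ring: "\<int> \<subseteq> valuation_ring"
  by (auto elim: Ints_cases)

section \<open>Limits and series in ultrametric fields\<close>

lemma tendsto_iff_vabs:
  "(f \<longlongrightarrow> (l::'a::ultrametric_field)) F \<longleftrightarrow> ((\<lambda>x. vabs (f x - l)) \<longlongrightarrow> 0) F"
  by (subst tendsto_dist_iff) (simp only: dist_vabs)

lemma tendsto_of_vabs_diff_le:
  fixes l :: "'a::ultrametric_field"
  assumes "\<And>x. vabs (f x - l) \<le> g x" and "(g \<longlongrightarrow> 0) F"
  shows "(f \<longlongrightarrow> l) F"
  unfolding tendsto_iff_vabs
  by (rule tendsto_sandwich[OF _ _ tendsto_const assms(2)]) (use assms(1) in auto)

lemma tendsto_vabs:
  fixes l :: "'a::ultrametric_field"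
  assumes "(f \<longlongrightarrow> l) F"
  shows "((\<lambda>x. vabs (f x)) \<longlongrightarrow> vabs l) F"
  using tendsto_dist[OF assms tendsto_const[of 0]] by (simp add: dist_vabs)

lemma vabs_fst_diff_tendsto_0:
  "((\<lambda>x. vabs (fst x - a)) \<longlongrightarrow> 0) (nhds (a::'a::ultrametric_field) \<times>\<^sub>F G)"
  using filterlim_fst[of "nhds a" G] by (simp add: tendsto_iff_vabs)

lemma vabs_snd_diff_tendsto_0:
  "((\<lambda>x. vabs (snd x - b)) \<longlongrightarrow> 0) (G \<times>\<^sub>F nhds (b::'a::ultrametric_field))"
  using filterlim_snd[of "nhds b" G] by (simp add: tendsto_iff_vabs)

instance ultrametric_field \<subseteq> topological_ab_group_add
proof
  fix a b :: 'a
  show "((\<lambda>x. fst x + snd x) \<longlongrightarrow> a + b) (nhds a \<times>\<^sub>F nhds b)"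
  proof (rule tendsto_of_vabs_diff_le)
    show "((\<lambda>x. vabs (fst x - a) + vabs (snd x - b)) \<longlongrightarrow> 0) (nhds a \<times>\<^sub>F nhds b)"
      using tendsto_add[OF vabs_fst_diff_tendsto_0 vabs_snd_diff_tendsto_0] by simp
    fix x :: "'a \<times> 'a"
    have "vabs (fst x + snd x - (a + b)) \<le> max (vabs (fst x - a)) (vabs (snd x - b))"
      using vabs_add_le_max[of "fst x - a" "snd x - b"] by (simp add: algebra_simps)
    then show "vabs (fst x + snd x - (a + b)) \<le> vabs (fst x - a) + vabs (snd x - b)"
      by (smt (verit) vabs_nonneg)
  qed
next
  fix a :: 'a
  have "((\<lambda>x. vabs (x - a)) \<longlongrightarrow> 0) (nhds a)"
    using filterlim_ident[of "nhds a"] by (simp only: tendsto_iff_vabs)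
  moreover have "vabs (- x - - a) = vabs (x - a)" for x
    by (metis minus_diff_minus vabs_minus)
  ultimately show "(uminus \<longlongrightarrow> - a) (nhds a)"
    by (simp only: tendsto_iff_vabs)
qed

instance ultrametric_field \<subseteq> topological_semigroup_mult
proof
  fix a b :: 'a
  let ?bound = "\<lambda>x. vabs (fst x - a) * vabs (snd x - b) + vabs a * vabs (snd x - b)
                  + vabs b * vabs (fst x - a)"
  show "((\<lambda>x. fst x * snd x) \<longlongrightarrow> a * b) (nhds a \<times>\<^sub>F nhds b)"
  proof (rule tendsto_of_vabs_diff_le)
    have "(?bound \<longlongrightarrow> 0 * 0 + vabs a * 0 + vabs b * 0) (nhds a \<times>\<^sub>F nhds b)"
      by (intro tendsto_intros vabs_fst_diff_tendsto_0 vabs_snd_diff_tendsto_0)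
    then show "(?bound \<longlongrightarrow> 0) (nhds a \<times>\<^sub>F nhds b)"
      by simp
    fix x :: "'a \<times> 'a"
    have "fst x * snd x - a * b = (fst x - a) * (snd x - b) + a * (snd x - b) + b * (fst x - a)"
      by (simp add: algebra_simps)
    then have "vabs (fst x * snd x - a * b)
        \<le> max (max (vabs ((fst x - a) * (snd x - b))) (vabs (a * (snd x - b))))
            (vabs (b * (fst x - a)))"
      by (smt (verit) vabs_add_le_max)
    then show "vabs (fst x * snd x - a * b) \<le> ?bound x"
      by (smt (verit) mult_nonneg_nonneg vabs_mult vabs_nonneg)
  qed
qed

lemma tendsto_inverse_ultrametric:
  fixes a :: "'a::ultrametric_field"
  assumes f: "(f \<longlongrightarrow> a) F" and "a \<noteq> 0"
  shows "((\<lambda>x. inverse (f x)) \<longlongrightarrow> inverse a) F"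
proof -
  have "((\<lambda>x. vabs (f x - a) / (vabs a)\<^sup>2) \<longlongrightarrow> 0) F"
    using f \<open>a \<noteq> 0\<close> by (auto simp: tendsto_iff_vabs intro!: tendsto_divide_zero)
  moreover have "\<forall>\<^sub>F x in F. vabs (f x - a) / (vabs a)\<^sup>2 = vabs (inverse (f x) - inverse a)"
  proof (rule eventually_mono)
    show "\<forall>\<^sub>F x in F. vabs (f x - a) < vabs a"
      using tendstoD[OF f, of "vabs a"] \<open>a \<noteq> 0\<close> by (simp add: dist_vabs)
    fix x
    assume "vabs (f x - a) < vabs a"
    then have "vabs (f x) = vabs a"
      by (rule vabs_eq_of_diff_less)
    moreover from this have "f x \<noteq> 0"
      using \<open>a \<noteq> 0\<close> by auto
    then have "inverse (f x) - inverse a = (a - f x) / (f x * a)"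
      using \<open>a \<noteq> 0\<close> by (simp add: field_simps)
    ultimately show "vabs (f x - a) / (vabs a)\<^sup>2 = vabs (inverse (f x) - inverse a)"
      by (simp add: vabs_divide vabs_mult power2_eq_square vabs_minus_commute[of a])
  qed
  ultimately show ?thesis
    unfolding tendsto_iff_vabs by (rule Lim_transform_eventually)
qed

lemma convergent_ultrametric:
  fixes X :: "nat \<Rightarrow> 'a::ultrametric_field"
  assumes "complete (UNIV :: 'a set)" and "(\<lambda>n. X (Suc n) - X n) \<longlonglongrightarrow> 0"
  shows "convergent X"
proof -
  have "Cauchy X"
  proof (rule metric_CauchyI)
    fix e :: real
    assume "0 < e"
    then have "\<forall>\<^sub>F n in sequentially. vabs (X (Suc n) - X n) < e"
      using assms(2) by (simp add: tendsto_iff dist_vabs)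
    then obtain N where step: "\<And>n. n \<ge> N \<Longrightarrow> vabs (X (Suc n) - X n) < e"
      by (auto simp: eventually_sequentially)
    have near: "vabs (X (N + k) - X N) < e" for k
    proof (induction k)
      case (Suc k)
      then show ?case
        using step[of "N + k"] vabs_add_le_max[of "X (Suc (N + k)) - X (N + k)" "X (N + k) - X N"]
        by simp
    qed (use \<open>0 < e\<close> in simp)
    have "dist (X m) (X n) < e" if "m \<ge> N" "n \<ge> N" for m n
      using near[of "m - N"] near[of "n - N"] that
        vabs_diff_le_max[of "X m - X N" "X n - X N"] by (simp add: dist_vabs)
    then show "\<exists>M. \<forall>m\<ge>M. \<forall>n\<ge>M. dist (X m) (X n) < e"
      by blast
  qed
  then show ?thesis
    using assms(1) by (auto simp: complete_def convergent_def)
qed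

lemma summable_ultrametric:
  fixes f :: "nat \<Rightarrow> 'a::ultrametric_field"
  assumes "complete (UNIV :: 'a set)" and "f \<longlonglongrightarrow> 0"
  shows "summable f"
  unfolding summable_iff_convergent
  by (rule convergent_ultrametric[OF assms(1)]) (use assms(2) in simp)

lemma sums_LIMSEQ_zero_ultrametric:
  fixes f :: "nat \<Rightarrow> 'a::ultrametric_field"
  assumes "f sums s"
  shows "f \<longlonglongrightarrow> 0"
  using tendsto_diff[OF LIMSEQ_Suc[OF assms[unfolded sums_def]] assms[unfolded sums_def]] by simp

lemma sums_diff_ultrametric:
  fixes f g :: "nat \<Rightarrow> 'a::ultrametric_field"
  assumes "f sums s" and "g sums t"
  shows "(\<lambda>n. f n - g n) sums (s - t)"
  using tendsto_diff[OF assms[unfolded sums_def]] by (simp add: sums_def sum_subtractf)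

lemma vabs_sums_le:
  fixes f :: "nat \<Rightarrow> 'a::ultrametric_field"
  assumes "f sums s" and "\<And>n. vabs (f n) \<le> B"
  shows "vabs s \<le> B"
proof (rule LIMSEQ_le_const2)
  show "(\<lambda>n. vabs (\<Sum>i<n. f i)) \<longlonglongrightarrow> vabs s"
    using assms(1) by (intro tendsto_vabs) (simp add: sums_def)
  have "0 \<le> B"
    using assms(2)[of 0] vabs_nonneg order_trans by blast
  then show "\<exists>N. \<forall>n\<ge>N. vabs (\<Sum>i<n. f i) \<le> B"
    using assms(2) by (blast intro: vabs_sum_le)
qed

lemma tannery_ultrametric:
  fixes f :: "'b \<Rightarrow> nat \<Rightarrow> 'a::ultrametric_field"
  assumes f: "\<And>x. f x sums s x" and g: "g sums t"
    and pointwise: "\<And>n. ((\<lambda>x. f x n) \<longlongrightarrow> g n) F"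
    and bound: "\<And>x n. vabs (f x n) \<le> b n" and b: "b \<longlonglongrightarrow> 0"
  shows "(s \<longlongrightarrow> t) F"
  unfolding tendsto_iff
proof (intro allI impI)
  fix e :: real
  assume "0 < e"
  then have half: "0 < e / 2"
    by simp
  have "\<forall>\<^sub>F n in sequentially. b n < e / 2 \<and> vabs (g n) < e / 2"
    using order_tendstoD(2)[OF b half]
      order_tendstoD(2)[OF tendsto_vabs[OF sums_LIMSEQ_zero_ultrametric[OF g]], of "e / 2"] half
    by (intro eventually_conj) simp_all
  then obtain M where M: "\<And>n. n \<ge> M \<Longrightarrow> b n < e / 2" "\<And>n. n \<ge> M \<Longrightarrow> vabs (g n) < e / 2"
    by (auto simp: eventually_sequentially)
  have "\<forall>\<^sub>F x in F. \<forall>n\<in>{..<M}. vabs (f x n - g n) < e / 2"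
    using tendstoD[OF pointwise half] by (intro eventually_ball_finite) (simp_all flip: dist_vabs)
  then show "\<forall>\<^sub>F x in F. dist (s x) t < e"
  proof (rule eventually_mono)
    fix x
    assume initial: "\<forall>n\<in>{..<M}. vabs (f x n - g n) < e / 2"
    have "vabs (f x n - g n) \<le> e / 2" for n
    proof (cases "n < M")
      case False
      then show ?thesis
        using M[of n] bound[of x n] vabs_diff_le_max[of "f x n" "g n"] by simp
    qed (use initial in \<open>simp add: less_imp_le\<close>)
    then have "vabs (s x - t) \<le> e / 2"
      using vabs_sums_le[OF sums_diff_ultrametric[OF f g]] by blast
    then show "dist (s x) t < e"
      using \<open>0 < e\<close> by (simp add: dist_vabs)
  qed
qed

lemma sum_product_triangle_complement_tendsto_0:
  fixes a b :: "nat \<Rightarrow> 'a::ultrametric_field"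
  assumes a: "a \<longlonglongrightarrow> 0" and b: "b \<longlonglongrightarrow> 0"
  shows "(\<lambda>n. \<Sum>(i, j)\<in>{..<n} \<times> {..<n} - {(i, j). i + j < n}. a i * b j) \<longlonglongrightarrow> 0"
  unfolding tendsto_iff
proof (intro allI impI)
  define c where "c n = max (vabs (a n)) (vabs (b n))" for n
  have "c \<longlonglongrightarrow> 0"
    using tendsto_max[OF tendsto_vabs[OF a] tendsto_vabs[OF b]] by (simp add: c_def[abs_def])
  then have "Bseq c"
    by (intro convergent_imp_Bseq convergentI)
  then obtain K where K: "0 < K" "\<And>n. c n \<le> K"
    by (metis BseqE abs_le_D1 real_norm_def)
  fix e :: real
  assume "0 < e"
  then obtain M where M: "\<And>n. n \<ge> M \<Longrightarrow> c n < e / 2 / K"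
    using order_tendstoD(2)[OF \<open>c \<longlonglongrightarrow> 0\<close>, of "e / 2 / K"] K(1)
    by (auto simp: eventually_sequentially)
  have c_nonneg: "0 \<le> c n" for n
    by (simp add: c_def le_max_iff_disj)
  have product: "c i * c j \<le> e / 2" if "M \<le> i" for i j
    using mult_mono[OF less_imp_le[OF M[OF that]] K(2)[of j]] K(1) c_nonneg \<open>0 < e\<close> by simp
  have "vabs (a i * b j) \<le> e / 2" if "2 * M \<le> i + j" for i j
  proof -
    have "vabs (a i * b j) \<le> c i * c j"
      unfolding vabs_mult by (intro mult_mono) (simp_all add: c_def le_max_iff_disj)
    also have "\<dots> \<le> e / 2"
      using product[of i j] product[of j i] that by (cases "M \<le> i") (simp_all add: mult.commute)
    finally show ?thesis .
  qed
  then have "vabs (\<Sum>(i, j)\<in>{..<n} \<times> {..<n} - {(i, j). i + j < n}. a i * b j) \<le> e / 2"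
    if "2 * M \<le> n" for n
    using that \<open>0 < e\<close> by (intro vabs_sum_le) auto
  moreover have "e / 2 < e"
    using \<open>0 < e\<close> by simp
  ultimately show "\<forall>\<^sub>F n in sequentially.
      dist (\<Sum>(i, j)\<in>{..<n} \<times> {..<n} - {(i, j). i + j < n}. a i * b j) 0 < e"
    unfolding eventually_sequentially dist_vabs diff_zero by (meson order_le_less_trans)
qed

lemma Cauchy_product_sums_ultrametric:
  fixes a b :: "nat \<Rightarrow> 'a::ultrametric_field"
  assumes a: "a sums s" and b: "b sums t"
  shows "(\<lambda>k. \<Sum>i\<le>k. a i * b (k - i)) sums (s * t)"
proof -
  define rest where
    "rest n = (\<Sum>(i, j)\<in>{..<n} \<times> {..<n} - {(i, j). i + j < n}. a i * b j)" for n
  have "(\<Sum>k<n. \<Sum>i\<le>k. a i * b (k - i)) = (\<Sum>i<n. a i) * (\<Sum>j<n. b j) - rest n" for n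
  proof -
    have "(\<Sum>k<n. \<Sum>i\<le>k. a i * b (k - i)) = (\<Sum>(i, j)\<in>{(i, j). i + j < n}. a i * b j)"
      using sum.triangle_reindex[of "\<lambda>i j. a i * b j" n] by simp
    moreover have "(\<Sum>i<n. a i) * (\<Sum>j<n. b j) = (\<Sum>(i, j)\<in>{..<n} \<times> {..<n}. a i * b j)"
      by (simp add: sum_product sum.cartesian_product)
    moreover have "{(i, j). i + j < n} \<subseteq> {..<n} \<times> {..<n}"
      by auto
    ultimately show ?thesis
      by (simp add: rest_def sum_diff)
  qed
  moreover have "(\<lambda>n. (\<Sum>i<n. a i) * (\<Sum>j<n. b j) - rest n) \<longlonglongrightarrow> s * t - 0"
    unfolding rest_def
    using a b by (intro tendsto_diff tendsto_mult sum_product_triangle_complement_tendsto_0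
        sums_LIMSEQ_zero_ultrametric) (auto simp: sums_def)
  ultimately show ?thesis
    by (simp add: sums_def)
qed

lemma one_plus_power_minus_1_sums:
  fixes z :: "'a::{field_char_0, topological_space}"
  assumes "0 < k"
  shows "(\<lambda>n. of_nat ((k - 1) choose n) / of_nat (Suc n) * z ^ Suc n) sums
    (((1 + z) ^ k - 1) / of_nat k)"
proof -
  have coeff: "of_nat ((k - 1) choose n) / of_nat (Suc n)
      = (of_nat (k choose Suc n) / of_nat k :: 'a)" for n
  proof -
    have "of_nat (Suc n) * of_nat (k choose Suc n) = (of_nat k * of_nat ((k - 1) choose n) :: 'a)"
      by (metis binomial_absorption of_nat_mult)
    then show ?thesis
      using assms by (simp add: frac_eq_eq mult.commute del: of_nat_Suc)
  qed
  have "(1 + z) ^ k = (\<Sum>j<Suc k. of_nat (k choose j) * z ^ j)"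
    using binomial_ring[of z 1 k] by (simp add: add.commute lessThan_Suc_atMost)
  also have "\<dots> = 1 + (\<Sum>n<k. of_nat (k choose Suc n) * z ^ Suc n)"
    by (subst sum.lessThan_Suc_shift) simp
  finally have "((1 + z) ^ k - 1) / of_nat k
      = (\<Sum>n<k. of_nat ((k - 1) choose n) / of_nat (Suc n) * z ^ Suc n)"
    by (simp only: coeff) (simp add: sum_divide_distrib)
  then show ?thesis
    using assms
      sums_finite[of "{..<k}" "\<lambda>n. of_nat ((k - 1) choose n) / of_nat (Suc n) * z ^ Suc n"]
    by (simp add: binomial_eq_0)
qed

lemma lipschitz_on_mult_ultrametric:
  fixes f g :: "'b::metric_space \<Rightarrow> 'a::ultrametric_field"
  assumes f: "C-lipschitz_on S f" and g: "C-lipschitz_on S g"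
    and "f ` S \<subseteq> valuation_ring" and "g ` S \<subseteq> valuation_ring"
  shows "C-lipschitz_on S (\<lambda>x. f x * g x)"
proof (rule lipschitz_onI[OF _ lipschitz_on_nonneg[OF f]])
  fix x y
  assume xy: "x \<in> S" "y \<in> S"
  have "f x * g x - f y * g y = f x * (g x - g y) + (f x - f y) * g y"
    by (simp add: algebra_simps)
  then have "dist (f x * g x) (f y * g y)
      \<le> max (vabs (f x) * dist (g x) (g y)) (dist (f x) (f y) * vabs (g y))"
    using vabs_add_le_max by (metis dist_vabs vabs_mult)
  also have "\<dots> \<le> max (dist (g x) (g y)) (dist (f x) (f y))"
    using assms(3,4) xy
    by (intro max.mono mult_left_le_one_le mult_right_le_one_le) (auto simp: valuation_ring_def)
  also have "\<dots> \<le> C * dist x y"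
    using lipschitz_onD[OF f xy] lipschitz_onD[OF g xy] by simp
  finally show "dist (f x * g x) (f y * g y) \<le> C * dist x y" .
qed

lemma lipschitz_on_power_ultrametric:
  fixes f :: "'b::metric_space \<Rightarrow> 'a::ultrametric_field"
  assumes f: "C-lipschitz_on S f" and range: "f ` S \<subseteq> valuation_ring"
  shows "C-lipschitz_on S (\<lambda>x. f x ^ n)"
proof (induction n)
  case 0
  show ?case
    using lipschitz_on_nonneg[OF f] by (simp add: lipschitz_on_def)
next
  case (Suc n)
  have "(\<lambda>x. f x ^ n) ` S \<subseteq> valuation_ring"
    using range by (auto intro: valuation_ring_power)
  then show ?case
    using lipschitz_on_mult_ultrametric[OF f Suc range] by simp
qed

section \<open>Alternating sums\<close>

definition alternating_sum :: "('a::comm_ring_1 \<Rightarrow> 'a) \<Rightarrow> nat \<Rightarrow> 'a" where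
  "alternating_sum f n = (\<Sum>y<n. f (of_nat y) * (-1) ^ y)"

lemma alternating_sum_cong:
  "(\<And>y. f (of_nat y) = g (of_nat y)) \<Longrightarrow> alternating_sum f n = alternating_sum g n"
  by (simp add: alternating_sum_def)

lemma alternating_sum_cmult: "alternating_sum (\<lambda>y. c * f y) n = c * alternating_sum f n"
  by (simp add: alternating_sum_def sum_distrib_left mult.assoc)

lemma alternating_sum_add:
  "alternating_sum f (m + n)
    = alternating_sum f m + (-1) ^ m * alternating_sum (\<lambda>y. f (y + of_nat m)) n"
  by (induction n) (simp_all add: alternating_sum_def algebra_simps power_add)

lemma alternating_sum_shift:
  "alternating_sum (\<lambda>y. f (y + 1)) n + alternating_sum f n = f 0 - (-1) ^ n * f (of_nat n)"
  by (induction n) (simp_all add: alternating_sum_def algebra_simps)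

lemma alternating_sum_reflect:
  assumes "odd n"
  shows "alternating_sum (\<lambda>y. f (- 1 - y)) n = alternating_sum (\<lambda>y. f (y - of_nat n)) n"
proof -
  have "alternating_sum (\<lambda>y. f (- 1 - y)) n
      = (\<Sum>y<n. f (- 1 - of_nat (n - Suc y)) * (-1) ^ (n - Suc y))"
    unfolding alternating_sum_def by (rule sum.nat_diff_reindex[symmetric])
  also have "\<dots> = (\<Sum>y<n. f (of_nat y - of_nat n) * (-1) ^ y)"
  proof (rule sum.cong[OF refl])
    fix y
    assume "y \<in> {..<n}"
    then have "y < n"
      by simp
    then have "- 1 - of_nat (n - Suc y) = (of_nat y - of_nat n :: 'a)"
      by (simp add: of_nat_diff)
    moreover have "even (n - Suc y) \<longleftrightarrow> even y"
      using \<open>y < n\<close> \<open>odd n\<close> by presburger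
    then have "(-1) ^ (n - Suc y) = ((-1) ^ y :: 'a)"
      by (simp add: minus_one_power_iff)
    ultimately show "f (- 1 - of_nat (n - Suc y)) * (-1) ^ (n - Suc y)
        = f (of_nat y - of_nat n) * (-1) ^ y"
      by simp
  qed
  finally show ?thesis
    by (simp add: alternating_sum_def)
qed

lemma vabs_alternating_sum_diff_le:
  fixes f g :: "'a::ultrametric_field \<Rightarrow> 'a"
  assumes "\<And>y. vabs (f (of_nat y) - g (of_nat y)) \<le> B"
  shows "vabs (alternating_sum f n - alternating_sum g n) \<le> B"
proof -
  have "alternating_sum f n - alternating_sum g n
      = (\<Sum>y<n. (f (of_nat y) - g (of_nat y)) * (-1) ^ y)"
    by (simp add: alternating_sum_def left_diff_distrib sum_subtractf)
  also have "vabs \<dots> \<le> B"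
  proof (rule vabs_sum_le)
    show "0 \<le> B"
      using assms[of 0] vabs_nonneg order_trans by blast
  qed (simp add: assms vabs_mult vabs_power)
  finally show ?thesis .
qed

definition almost_period :: "('a::ultrametric_field \<Rightarrow> 'a) \<Rightarrow> real \<Rightarrow> nat \<Rightarrow> bool" where
  "almost_period f B n \<longleftrightarrow> (\<forall>k\<in>\<int>. vabs (f (k + of_nat n) - f k) \<le> B)"

lemma almost_periodD:
  "almost_period f B n \<Longrightarrow> k \<in> \<int> \<Longrightarrow> vabs (f (k + of_nat n) - f k) \<le> B"
  by (simp add: almost_period_def)

lemma vabs_alternating_sum_add_le:
  assumes "almost_period f B n" and "odd n"
  shows "vabs (alternating_sum f (n + k) - (alternating_sum f n - alternating_sum f k)) \<le> B"
proof -
  have "alternating_sum f (n + k) - (alternating_sum f n - alternating_sum f k)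
      = alternating_sum f k - alternating_sum (\<lambda>y. f (y + of_nat n)) k"
    using \<open>odd n\<close> by (simp add: alternating_sum_add)
  also have "vabs \<dots> \<le> B"
    using almost_periodD[OF assms(1)]
    by (intro vabs_alternating_sum_diff_le) (simp add: vabs_minus_commute)
  finally show ?thesis .
qed

lemma vabs_alternating_sum_odd_mult_le:
  assumes f: "almost_period f B n" and "odd n" and "odd i"
  shows "vabs (alternating_sum f (i * n) - alternating_sum f n) \<le> B"
proof -
  have "vabs (alternating_sum f ((2 * j + 1) * n) - alternating_sum f n) \<le> B" for j
  proof (induction j)
    case 0
    show ?case
      using order_trans[OF vabs_nonneg almost_periodD[OF f Ints_0]] by simp
  next
    case (Suc j)
    define k where "k = (2 * j + 1) * n"
    let ?S = "alternating_sum f"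
    have "?S (n + (n + k)) - ?S n = (?S (n + (n + k)) - (?S n - ?S (n + k)))
        - (?S (n + k) - (?S n - ?S k)) + (?S k - ?S n)"
      by simp
    also have "vabs \<dots> \<le> B"
      using vabs_alternating_sum_add_le[OF f \<open>odd n\<close>] Suc unfolding k_def
      by (meson max.boundedI order_trans vabs_add_le_max vabs_diff_le_max)
    also have "n + (n + k) = (2 * Suc j + 1) * n"
      by (simp add: k_def)
    finally show ?case .
  qed
  then show ?thesis
    using \<open>odd i\<close> by (auto elim: oddE)
qed

lemma vabs_alternating_sum_reflect_le:
  assumes "almost_period f B n" and "odd n"
  shows "vabs (alternating_sum (\<lambda>y. f (- 1 - y)) n - alternating_sum f n) \<le> B"
  unfolding alternating_sum_reflect[OF \<open>odd n\<close>]
proof (rule vabs_alternating_sum_diff_le)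
  fix y
  show "vabs (f (of_nat y - of_nat n) - f (of_nat y)) \<le> B"
    using almost_periodD[OF assms(1), of "of_nat y - of_nat n"] by (simp add: vabs_minus_commute)
qed

lemma vabs_alternating_sum_shift_le:
  assumes "almost_period f B n" and "odd n"
  shows "vabs (alternating_sum (\<lambda>y. f (y + 1)) n + alternating_sum f n - 2 * f 0) \<le> B"
  using almost_periodD[OF assms(1), of 0] \<open>odd n\<close> by (simp add: alternating_sum_shift)

section \<open>Power series tangent to the identity\<close>

locale padic_field =
  fixes p :: nat and T :: "'a::ultrametric_field itself"
  assumes prime_p: "prime p"
    and vabs_p: "vabs (of_nat p :: 'a) = 1 / real p"
    and complete_UNIV: "complete (UNIV :: 'a set)"
begin

lemma p_gt_1: "1 < p"
  using prime_p by (rule prime_gt_1_nat)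

lemma vabs_p_power: "vabs (of_nat (p ^ N) :: 'a) = (1 / real p) ^ N"
  by (simp add: vabs_power vabs_p)

lemma vabs_p_power_tendsto_0: "(\<lambda>N. vabs (of_nat (p ^ N) :: 'a)) \<longlonglongrightarrow> 0"
  unfolding vabs_p_power using p_gt_1 by (intro LIMSEQ_realpow_zero) auto

lemma p_power_tendsto_0: "(\<lambda>N. of_nat (p ^ N) :: 'a) \<longlonglongrightarrow> 0"
  unfolding tendsto_iff_vabs diff_zero by (rule vabs_p_power_tendsto_0)

lemma vabs_of_nat_eq_1:
  assumes "\<not> p dvd n"
  shows "vabs (of_nat n :: 'a) = 1"
proof (rule ccontr)
  assume "vabs (of_nat n :: 'a) \<noteq> 1"
  then have n: "vabs (of_nat n :: 'a) < 1"
    using vabs_of_nat_le_1[of n, where 'a='a] by simp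
  have p: "vabs (of_nat p :: 'a) < 1"
    using p_gt_1 by (simp add: vabs_p)
  have "coprime (int p) (int n)"
    using prime_imp_coprime[OF prime_p assms] by simp
  then obtain u v where "u * int p + v * int n = 1"
    using bezout_int[of "int p" "int n"] by (auto simp: coprime_iff_gcd_eq_1)
  then have "of_int (u * int p + v * int n) = (1::'a)"
    by simp
  then have "1 = vabs (of_int u * of_nat p + of_int v * of_nat n :: 'a)"
    by simp
  also have "\<dots> \<le> max (vabs (of_int u * of_nat p :: 'a)) (vabs (of_int v * of_nat n :: 'a))"
    by (rule vabs_add_le_max)
  also have "\<dots> < 1"
    using n p by (simp add: order_le_less_trans[OF vabs_of_int_mult_le])
  finally show False
    by simp
qed

definition radius :: real where
  "radius = real p powr (- 1 / (real p - 1))"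

lemma radius_pos: "0 < radius"
  using p_gt_1 by (simp add: radius_def)

lemma radius_less_1: "radius < 1"
  using p_gt_1 by (simp add: radius_def powr_less_one)

lemma radius_power: "radius ^ (p - 1) = 1 / real p"
proof -
  have "radius ^ (p - 1) = radius powr real (p - 1)"
    using radius_pos by (simp add: powr_realpow)
  also have "\<dots> = real p powr (- 1)"
    using p_gt_1 unfolding radius_def by (simp add: powr_powr)
  finally show ?thesis
    using p_gt_1 by (simp add: powr_minus_divide)
qed

lemma vabs_fact_div:
  "vabs (fact n :: 'a) = (1 / real p) ^ (n div p) * vabs (fact (n div p) :: 'a)"
proof (induction n)
  case (Suc n)
  have fact_Suc_n: "vabs (fact (Suc n) :: 'a) = vabs (of_nat (Suc n) :: 'a) * vabs (fact n :: 'a)"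
    by (simp only: fact_Suc vabs_mult)
  show ?case
  proof (cases "p dvd Suc n")
    case True
    then have div: "Suc n div p = Suc (n div p)"
      by (simp add: div_Suc dvd_eq_mod_eq_0)
    then have "Suc n = p * Suc (n div p)"
      using True by (metis dvd_mult_div_cancel)
    then have "vabs (of_nat (Suc n) :: 'a) = 1 / real p * vabs (of_nat (Suc (n div p)) :: 'a)"
      by (metis of_nat_mult vabs_mult vabs_p)
    then show ?thesis
      unfolding fact_Suc_n div Suc.IH fact_Suc[of "n div p"] vabs_mult power_Suc
      by (simp only: mult_ac)
  next
    case False
    then have "Suc n div p = n div p"
      by (simp add: div_Suc dvd_eq_mod_eq_0)
    then show ?thesis
      using fact_Suc_n vabs_of_nat_eq_1[OF False] Suc.IH by simp
  qed
qed simp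

text \<open>This is Legendre's estimate \<open>v\<^sub>p(n!) \<le> (n - 1) / (p - 1)\<close>.\<close>

lemma vabs_fact_ge:
  assumes "0 < n"
  shows "radius ^ (n - 1) \<le> vabs (fact n :: 'a)"
  using assms
proof (induction n rule: less_induct)
  case (less n)
  define k where "k = n div p"
  show ?case
  proof (cases "k = 0")
    case True
    then show ?thesis
      using vabs_fact_div[of n] radius_pos radius_less_1 by (simp add: k_def power_le_one)
  next
    case False
    have "k < n"
      using less.prems p_gt_1 by (simp add: k_def)
    have "p * k \<le> n"
      by (simp add: k_def)
    moreover have "p * k = (p - 1) * k + k"
      using p_gt_1 by (simp add: mult_eq_if)
    ultimately have "(p - 1) * k + (k - 1) \<le> n - 1"
      using False by linarith
    then have "radius ^ (n - 1) \<le> radius ^ ((p - 1) * k + (k - 1))"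
      using radius_pos radius_less_1 by (intro power_decreasing) auto
    also have "\<dots> = (1 / real p) ^ k * radius ^ (k - 1)"
      by (simp only: power_add power_mult radius_power)
    also have "\<dots> \<le> (1 / real p) ^ k * vabs (fact k :: 'a)"
      using less.IH[OF \<open>k < n\<close>] False by (intro mult_left_mono) auto
    finally show ?thesis
      by (simp only: vabs_fact_div[of n] k_def)
  qed
qed

text \<open>
  Under these conditions \<open>\<Sum>a\<^sub>n z\<^sup>n\<^sup>+\<^sup>1\<close> has absolute value \<open>|z|\<close> whenever \<open>|z| < radius\<close>.
  The functions \<open>exp z - 1\<close>, \<open>log (1 + z)\<close> and \<open>((1 + z)\<^sup>k - 1) / k\<close> are all of this form.
\<close>

definition tangent_coeffs :: "(nat \<Rightarrow> 'a) \<Rightarrow> bool" where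
  "tangent_coeffs a \<longleftrightarrow> a 0 = 1 \<and> (\<forall>n. vabs (a n) \<le> 1 / radius ^ n)"

lemma tangent_coeffs_inverse_fact: "tangent_coeffs (\<lambda>n. 1 / fact (Suc n))"
  using vabs_fact_ge[of "Suc n" for n] radius_pos
  by (simp add: tangent_coeffs_def vabs_divide frac_le del: fact_Suc)

lemma tangent_coeffs_divide_Suc:
  assumes "c 0 = 1" and "\<And>n. c n \<in> valuation_ring"
  shows "tangent_coeffs (\<lambda>n. c n / of_nat (Suc n))"
proof -
  have "radius ^ n \<le> vabs (of_nat (Suc n) :: 'a)" for n
  proof -
    have "radius ^ n \<le> vabs (of_nat (Suc n) :: 'a) * vabs (of_nat (fact n) :: 'a)"
      using vabs_fact_ge[of "Suc n"] by (simp only: fact_Suc vabs_mult of_nat_fact) simp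
    also have "\<dots> \<le> vabs (of_nat (Suc n) :: 'a)"
      by (intro mult_left_le vabs_of_nat_le_1 vabs_nonneg)
    finally show ?thesis .
  qed
  then show ?thesis
    using assms radius_pos
    by (simp add: tangent_coeffs_def valuation_ring_def vabs_divide frac_le del: of_nat_Suc)
qed

lemma vabs_tangent_term_le:
  assumes "tangent_coeffs a"
  shows "vabs (a n * z ^ Suc n) \<le> vabs z * (vabs z / radius) ^ n"
proof -
  have "vabs (a n) * vabs z ^ Suc n \<le> 1 / radius ^ n * vabs z ^ Suc n"
    using assms by (intro mult_right_mono) (simp_all add: tangent_coeffs_def)
  then show ?thesis
    by (simp add: vabs_mult vabs_power power_divide)
qed

lemma tangent_term_bound_tendsto_0:
  fixes z :: 'a
  assumes "vabs z < radius"
  shows "(\<lambda>n. vabs z * (vabs z / radius) ^ n) \<longlonglongrightarrow> 0"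
  using assms radius_pos by (intro tendsto_mult_right_zero LIMSEQ_realpow_zero) auto

lemma summable_tangent:
  assumes "tangent_coeffs a" and "vabs z < radius"
  shows "summable (\<lambda>n. a n * z ^ Suc n)"
proof (rule summable_ultrametric[OF complete_UNIV])
  show "(\<lambda>n. a n * z ^ Suc n) \<longlonglongrightarrow> 0"
    by (rule tendsto_of_vabs_diff_le[OF _ tangent_term_bound_tendsto_0[OF assms(2)]])
      (simp only: diff_zero vabs_tangent_term_le[OF assms(1)])
qed

lemma vabs_tangent_sums_diff_le:
  assumes a: "tangent_coeffs a" and z: "vabs z < radius"
    and sums: "(\<lambda>n. a n * z ^ Suc n) sums s"
  shows "vabs (s - z) \<le> (vabs z)\<^sup>2 / radius"
proof (rule vabs_sums_le[OF sums_diff_ultrametric[OF sums sums_single[of 0]]])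
  fix n
  show "vabs (a n * z ^ Suc n - (if n = 0 then z else 0)) \<le> (vabs z)\<^sup>2 / radius"
  proof (cases n)
    case 0
    then show ?thesis
      using a radius_pos by (simp add: tangent_coeffs_def)
  next
    case (Suc k)
    have "vabs (a n * z ^ Suc n) \<le> vabs z * (vabs z / radius) ^ Suc k"
      using vabs_tangent_term_le[OF a, of n z] by (simp only: Suc)
    also have "\<dots> \<le> vabs z * (vabs z / radius) ^ 1"
      using z radius_pos by (intro mult_left_mono power_decreasing) auto
    finally show ?thesis
      using Suc by (simp add: power2_eq_square)
  qed
qed

lemma vabs_tangent_sums:
  assumes a: "tangent_coeffs a" and z: "vabs z < radius"
    and sums: "(\<lambda>n. a n * z ^ Suc n) sums s"
  shows "vabs s = vabs z"
proof (cases "z = 0")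
  case True
  then show ?thesis
    using vabs_tangent_sums_diff_le[OF assms] by simp
next
  case False
  then have "(vabs z)\<^sup>2 / radius < vabs z"
    using z radius_pos by (simp add: power2_eq_square field_simps)
  then show ?thesis
    using vabs_tangent_sums_diff_le[OF assms] by (intro vabs_eq_of_diff_less) simp
qed

section \<open>The exponential\<close>

lemma padic_exp_minus_1_sums:
  fixes z :: 'a
  assumes "vabs z < radius"
  shows "(\<lambda>n. 1 / fact (Suc n) * z ^ Suc n) sums (padic_exp z - 1)"
proof -
  obtain s where s: "(\<lambda>n. 1 / fact (Suc n) * z ^ Suc n) sums s"
    using summable_tangent[OF tangent_coeffs_inverse_fact assms] by (auto simp: summable_def)
  then have "(\<lambda>n. z ^ n / fact n) sums (s + 1)"
    using sums_Suc[of "\<lambda>n. z ^ n / fact n" s] by simp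
  then have "padic_exp z = s + 1"
    unfolding padic_exp_def by (rule sums_unique[symmetric])
  then show ?thesis
    using s by simp
qed

lemma padic_exp_sums:
  fixes z :: 'a
  assumes "vabs z < radius"
  shows "(\<lambda>n. z ^ n / fact n) sums padic_exp z"
  using sums_Suc[of "\<lambda>n. z ^ n / fact n" "padic_exp z - 1"] padic_exp_minus_1_sums[OF assms]
  by simp

lemma vabs_padic_exp_diff_le:
  fixes z :: 'a
  assumes "vabs z < radius"
  shows "vabs (padic_exp z - 1 - z) \<le> (vabs z)\<^sup>2 / radius"
  by (rule vabs_tangent_sums_diff_le[OF tangent_coeffs_inverse_fact assms
        padic_exp_minus_1_sums[OF assms]])

lemma vabs_padic_exp_minus_1:
  fixes z :: 'a
  assumes "vabs z < radius"
  shows "vabs (padic_exp z - 1) = vabs z"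
  by (rule vabs_tangent_sums[OF tangent_coeffs_inverse_fact assms
        padic_exp_minus_1_sums[OF assms]])

lemma padic_exp_0: "padic_exp (0::'a) = 1"
  using vabs_padic_exp_minus_1[of 0] radius_pos by simp

lemma padic_exp_add:
  fixes x y :: 'a
  assumes x: "vabs x < radius" and y: "vabs y < radius"
  shows "padic_exp (x + y) = padic_exp x * padic_exp y"
proof (rule sums_unique2)
  have "vabs (x + y) < radius"
    using vabs_add_le_max[of x y] x y by simp
  then show "(\<lambda>k. (x + y) ^ k / fact k) sums padic_exp (x + y)"
    by (rule padic_exp_sums)
  have "(\<Sum>i\<le>k. x ^ i / fact i * (y ^ (k - i) / fact (k - i))) = (x + y) ^ k / fact k" for k
    by (simp add: binomial_ring sum_divide_distrib binomial_fact)
  then show "(\<lambda>k. (x + y) ^ k / fact k) sums (padic_exp x * padic_exp y)"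
    using Cauchy_product_sums_ultrametric[OF padic_exp_sums[OF x]
        padic_exp_sums[OF y]] by simp
qed

lemma padic_exp_uminus:
  fixes z :: 'a
  assumes "vabs z < radius"
  shows "padic_exp (- z) = inverse (padic_exp z)"
  using padic_exp_add[of z "- z"] assms by (simp add: padic_exp_0 inverse_unique)

lemma padic_exp_of_nat_mult:
  fixes z :: 'a
  assumes "vabs z < radius"
  shows "padic_exp (of_nat n * z) = padic_exp z ^ n"
proof (induction n)
  case (Suc n)
  have "vabs (of_nat n * z) < radius"
    using vabs_of_int_mult_le[of "int n" z] assms by simp
  then show ?case
    using padic_exp_add[of z "of_nat n * z"] assms Suc by (simp add: algebra_simps)
qed (simp add: padic_exp_0)

lemma padic_exp_of_int_mult:
  fixes z :: 'a
  assumes "vabs z < radius"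
  shows "padic_exp (of_int k * z) = padic_exp z powi k"
proof (cases k rule: int_cases2)
  case (nonneg n)
  then show ?thesis
    using padic_exp_of_nat_mult[OF assms] by simp
next
  case (nonpos n)
  have "vabs (of_nat n * z) < radius"
    using vabs_of_int_mult_le[of "int n" z] assms by simp
  then show ?thesis
    using padic_exp_uminus[of "of_nat n * z"] padic_exp_of_nat_mult[OF assms] nonpos
    by (simp add: power_int_minus)
qed

section \<open>The logarithm\<close>

definition exp_units :: "'a set" where
  "exp_units = {u. vabs (u - 1) < radius}"

lemma vabs_exp_unit:
  assumes "u \<in> exp_units"
  shows "vabs u = 1"
  using vabs_eq_of_diff_less[of u 1] assms radius_less_1 by (simp add: exp_units_def)

lemma exp_unit_nonzero: "u \<in> exp_units \<Longrightarrow> u \<noteq> 0"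
  using vabs_exp_unit by fastforce

lemma exp_units_1: "1 \<in> exp_units"
  by (simp add: exp_units_def radius_pos)

lemma exp_units_mult:
  assumes "u \<in> exp_units" and "v \<in> exp_units"
  shows "u * v \<in> exp_units"
proof -
  have "vabs (u * v - 1) = vabs (u * (v - 1) + (u - 1))"
    by (simp add: algebra_simps)
  also have "\<dots> \<le> max (vabs (u * (v - 1))) (vabs (u - 1))"
    by (rule vabs_add_le_max)
  also have "\<dots> < radius"
    using assms vabs_exp_unit[OF assms(1)] by (simp add: exp_units_def vabs_mult)
  finally show ?thesis
    by (simp add: exp_units_def)
qed

lemma exp_units_inverse:
  assumes "u \<in> exp_units"
  shows "inverse u \<in> exp_units"
proof -
  have "inverse u - 1 = - ((u - 1) / u)"
    using exp_unit_nonzero[OF assms] by (simp add: field_simps)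
  then have "vabs (inverse u - 1) = vabs (u - 1)"
    using vabs_exp_unit[OF assms] by (simp only: vabs_minus vabs_divide div_by_1)
  then show ?thesis
    using assms by (simp add: exp_units_def)
qed

lemma padic_exp_in_exp_units: "vabs z < radius \<Longrightarrow> padic_exp z \<in> exp_units"
  by (simp add: exp_units_def vabs_padic_exp_minus_1)

lemma tangent_coeffs_padic_log: "tangent_coeffs (\<lambda>n. (-1) ^ n / of_nat (Suc n))"
  by (rule tangent_coeffs_divide_Suc) (simp_all add: valuation_ring_def vabs_power)

lemma padic_log_sums:
  assumes "u \<in> exp_units"
  shows "(\<lambda>n. (-1) ^ n / of_nat (Suc n) * (u - 1) ^ Suc n) sums padic_log u"
  using summable_tangent[OF tangent_coeffs_padic_log, of "u - 1"] assms
  by (simp add: exp_units_def padic_log_def summable_sums del: of_nat_Suc power_Suc)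

lemma vabs_padic_log:
  assumes "u \<in> exp_units"
  shows "vabs (padic_log u) = vabs (u - 1)"
  using vabs_tangent_sums[OF tangent_coeffs_padic_log _ padic_log_sums[OF assms]] assms
  by (simp add: exp_units_def)

lemma vabs_padic_log_less_radius: "u \<in> exp_units \<Longrightarrow> vabs (padic_log u) < radius"
  by (simp add: vabs_padic_log exp_units_def)

lemma p_power_choose_Suc_tendsto_0: "(\<lambda>N. of_nat (p ^ N choose Suc j) :: 'a) \<longlonglongrightarrow> 0"
proof (rule tendsto_of_vabs_diff_le)
  show "(\<lambda>N. vabs (of_nat (p ^ N) :: 'a) / vabs (of_nat (Suc j) :: 'a)) \<longlonglongrightarrow> 0"
    by (rule tendsto_divide_zero[OF vabs_p_power_tendsto_0])
  fix N
  have "vabs (of_nat (Suc j) :: 'a) * vabs (of_nat (p ^ N choose Suc j) :: 'a)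
      = vabs (of_nat (p ^ N) :: 'a) * vabs (of_nat ((p ^ N - 1) choose j) :: 'a)"
    by (metis binomial_absorption of_nat_mult vabs_mult)
  also have "\<dots> \<le> vabs (of_nat (p ^ N) :: 'a)"
    by (intro mult_left_le vabs_of_nat_le_1 vabs_nonneg)
  finally show "vabs (of_nat (p ^ N choose Suc j) - 0 :: 'a)
      \<le> vabs (of_nat (p ^ N) :: 'a) / vabs (of_nat (Suc j) :: 'a)"
    by (simp add: field_simps del: of_nat_Suc of_nat_power)
qed

lemma p_power_minus_1_choose_tendsto: "(\<lambda>N. of_nat ((p ^ N - 1) choose j) :: 'a) \<longlonglongrightarrow> (-1) ^ j"
proof (induction j)
  case (Suc j)
  have "of_nat (p ^ N choose Suc j)
      = (of_nat ((p ^ N - 1) choose j) + of_nat ((p ^ N - 1) choose Suc j) :: 'a)" for N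
    using p_gt_1 by (cases "p ^ N") simp_all
  then have "of_nat ((p ^ N - 1) choose Suc j)
      = (of_nat (p ^ N choose Suc j) - of_nat ((p ^ N - 1) choose j) :: 'a)" for N
    by simp
  then show ?case
    using tendsto_diff[OF p_power_choose_Suc_tendsto_0[of j] Suc] by simp
qed simp

lemma padic_log_limit:
  assumes "u \<in> exp_units"
  shows "(\<lambda>N. (u ^ p ^ N - 1) / of_nat (p ^ N)) \<longlonglongrightarrow> padic_log u"
proof (rule tannery_ultrametric)
  let ?coeff = "\<lambda>N n. of_nat ((p ^ N - 1) choose n) / of_nat (Suc n) :: 'a"
  show "(\<lambda>n. ?coeff N n * (u - 1) ^ Suc n) sums ((u ^ p ^ N - 1) / of_nat (p ^ N))" for N
    using one_plus_power_minus_1_sums[of "p ^ N" "u - 1"] p_gt_1 by simp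
  show "(\<lambda>n. (-1) ^ n / of_nat (Suc n) * (u - 1) ^ Suc n) sums padic_log u"
    by (rule padic_log_sums[OF assms])
  show "(\<lambda>N. ?coeff N n * (u - 1) ^ Suc n) \<longlonglongrightarrow> (-1) ^ n / of_nat (Suc n) * (u - 1) ^ Suc n" for n
    unfolding divide_inverse by (intro tendsto_mult tendsto_const p_power_minus_1_choose_tendsto)
  have "tangent_coeffs (?coeff N)" for N
    by (rule tangent_coeffs_divide_Suc) simp_all
  then show "vabs (?coeff N n * (u - 1) ^ Suc n)
      \<le> vabs (u - 1) * (vabs (u - 1) / radius) ^ n" for N n
    by (rule vabs_tangent_term_le)
  show "(\<lambda>n. vabs (u - 1) * (vabs (u - 1) / radius) ^ n) \<longlonglongrightarrow> 0"
    using assms by (intro tangent_term_bound_tendsto_0) (simp add: exp_units_def)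
qed

lemma exp_unit_power_p_power_tendsto_1:
  assumes "u \<in> exp_units"
  shows "(\<lambda>N. u ^ p ^ N) \<longlonglongrightarrow> 1"
proof -
  have "(\<lambda>N. of_nat (p ^ N) * ((u ^ p ^ N - 1) / of_nat (p ^ N)) + 1) \<longlonglongrightarrow> 0 * padic_log u + 1"
    by (intro tendsto_add tendsto_mult tendsto_const p_power_tendsto_0 padic_log_limit assms)
  then show ?thesis
    using p_gt_1 by simp
qed

lemma padic_log_mult:
  assumes "u \<in> exp_units" and "v \<in> exp_units"
  shows "padic_log (u * v) = padic_log u + padic_log v"
proof (rule LIMSEQ_unique)
  show "(\<lambda>N. ((u * v) ^ p ^ N - 1) / of_nat (p ^ N)) \<longlonglongrightarrow> padic_log (u * v)"
    by (intro padic_log_limit exp_units_mult assms)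
  have "(\<lambda>N. (u ^ p ^ N - 1) / of_nat (p ^ N) * v ^ p ^ N + (v ^ p ^ N - 1) / of_nat (p ^ N))
      \<longlonglongrightarrow> padic_log u * 1 + padic_log v"
    by (intro tendsto_add tendsto_mult padic_log_limit exp_unit_power_p_power_tendsto_1 assms)
  moreover have "(u ^ p ^ N - 1) / of_nat (p ^ N) * v ^ p ^ N + (v ^ p ^ N - 1) / of_nat (p ^ N)
      = ((u * v) ^ p ^ N - 1) / of_nat (p ^ N)" for N
    by (simp add: power_mult_distrib diff_divide_distrib left_diff_distrib)
  ultimately show "(\<lambda>N. ((u * v) ^ p ^ N - 1) / of_nat (p ^ N)) \<longlonglongrightarrow> padic_log u + padic_log v"
    by simp
qed

lemma padic_log_inverse:
  assumes "u \<in> exp_units"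
  shows "padic_log (inverse u) = - padic_log u"
proof -
  have "padic_log u + padic_log (inverse u) = padic_log 1"
    using padic_log_mult[OF assms exp_units_inverse[OF assms]] exp_unit_nonzero[OF assms] by simp
  moreover have "padic_log (1::'a) = 0"
    using vabs_padic_log[OF exp_units_1] by simp
  ultimately show ?thesis
    by (simp add: eq_neg_iff_add_eq_0 add.commute)
qed

lemma padic_log_inj_on: "inj_on padic_log exp_units"
proof (rule inj_onI)
  fix u v :: 'a
  assume u: "u \<in> exp_units" and v: "v \<in> exp_units" and eq: "padic_log u = padic_log v"
  have quotient: "u * inverse v \<in> exp_units"
    by (intro exp_units_mult exp_units_inverse u v)
  have "padic_log (u * inverse v) = 0"
    using padic_log_mult[OF u exp_units_inverse[OF v]] padic_log_inverse[OF v] eq by simp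
  then have "u * inverse v = 1"
    using vabs_padic_log[OF quotient] by simp
  then show "u = v"
    using exp_unit_nonzero[OF v] by (simp add: field_simps)
qed

lemma padic_log_exp:
  fixes z :: 'a
  assumes z: "vabs z < radius"
  shows "padic_log (padic_exp z) = z"
proof (rule LIMSEQ_unique[OF padic_log_limit[OF padic_exp_in_exp_units[OF z]]])
  show "(\<lambda>N. (padic_exp z ^ p ^ N - 1) / of_nat (p ^ N)) \<longlonglongrightarrow> z"
  proof (rule tendsto_of_vabs_diff_le)
    show "(\<lambda>N. vabs (of_nat (p ^ N) :: 'a) * ((vabs z)\<^sup>2 / radius)) \<longlonglongrightarrow> 0"
      by (rule tendsto_mult_left_zero[OF vabs_p_power_tendsto_0])
    fix N
    define P where "P = (of_nat (p ^ N) :: 'a)"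
    have "P \<noteq> 0"
      using p_gt_1 by (simp add: P_def)
    have "vabs (P * z) < radius"
      using vabs_of_int_mult_le[of "int (p ^ N)" z] z by (simp add: P_def)
    then have "vabs (padic_exp (P * z) - 1 - P * z) \<le> (vabs (P * z))\<^sup>2 / radius"
      by (rule vabs_padic_exp_diff_le)
    moreover have "(padic_exp z ^ p ^ N - 1) / P - z = (padic_exp (P * z) - 1 - P * z) / P"
      using padic_exp_of_nat_mult[OF z, of "p ^ N"] \<open>P \<noteq> 0\<close> by (simp add: P_def field_simps)
    ultimately show "vabs ((padic_exp z ^ p ^ N - 1) / of_nat (p ^ N) - z)
        \<le> vabs (of_nat (p ^ N) :: 'a) * ((vabs z)\<^sup>2 / radius)"
      unfolding P_def[symmetric] using \<open>P \<noteq> 0\<close>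
      by (simp add: vabs_divide vabs_mult power2_eq_square field_simps)
  qed
qed

lemma padic_exp_log:
  assumes "u \<in> exp_units"
  shows "padic_exp (padic_log u) = u"
proof (rule inj_onD[OF padic_log_inj_on])
  note log = vabs_padic_log_less_radius[OF assms]
  show "padic_log (padic_exp (padic_log u)) = padic_log u"
    by (rule padic_log_exp[OF log])
  show "padic_exp (padic_log u) \<in> exp_units"
    by (rule padic_exp_in_exp_units[OF log])
qed (rule assms)

section \<open>Powers with exponents in the valuation ring and \<open>q\<close>-numbers\<close>

lemma vabs_mult_padic_log_less_radius:
  assumes "u \<in> exp_units" and "x \<in> valuation_ring"
  shows "vabs (x * padic_log u) < radius"
proof -
  have "vabs (x * padic_log u) \<le> vabs (padic_log u)"
    using assms(2) by (simp add: vabs_mult valuation_ring_def mult_left_le_one_le)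
  then show ?thesis
    using vabs_padic_log_less_radius[OF assms(1)] by simp
qed

lemma padic_pow_add:
  assumes "u \<in> exp_units" and "x \<in> valuation_ring" and "y \<in> valuation_ring"
  shows "padic_pow u (x + y) = padic_pow u x * padic_pow u y"
  using padic_exp_add vabs_mult_padic_log_less_radius[OF assms(1)] assms(2,3)
  by (simp add: padic_pow_def distrib_right)

lemma padic_pow_of_int:
  assumes "u \<in> exp_units"
  shows "padic_pow u (of_int k) = u powi k"
  using padic_exp_of_int_mult[OF vabs_padic_log_less_radius[OF assms]] padic_exp_log[OF assms]
  by (simp add: padic_pow_def)

lemma padic_pow_of_nat:
  assumes "u \<in> exp_units"
  shows "padic_pow u (of_nat n) = u ^ n"
  using padic_pow_of_int[OF assms, of "int n"] by simp

lemma padic_pow_inverse: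
  assumes "u \<in> exp_units"
  shows "padic_pow (inverse u) x = padic_pow u (- x)"
  using padic_log_inverse[OF assms] by (simp add: padic_pow_def)

lemma vabs_padic_pow_minus_1:
  assumes "u \<in> exp_units" and "x \<in> valuation_ring"
  shows "vabs (padic_pow u x - 1) = vabs x * vabs (u - 1)"
  using vabs_padic_exp_minus_1[OF vabs_mult_padic_log_less_radius[OF assms]]
  by (simp add: padic_pow_def vabs_mult vabs_padic_log[OF assms(1)])

lemma vabs_padic_pow:
  assumes "u \<in> exp_units" and "x \<in> valuation_ring"
  shows "vabs (padic_pow u x) = 1"
  unfolding padic_pow_def
  by (intro vabs_exp_unit padic_exp_in_exp_units vabs_mult_padic_log_less_radius assms)

lemma vabs_padic_pow_diff:
  assumes u: "u \<in> exp_units" and x: "x \<in> valuation_ring" and y: "y \<in> valuation_ring"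
  shows "vabs (padic_pow u x - padic_pow u y) = vabs (x - y) * vabs (u - 1)"
proof -
  have "padic_pow u x - padic_pow u y = padic_pow u y * (padic_pow u (x - y) - 1)"
    using padic_pow_add[OF u y valuation_ring_diff[OF x y]] by (simp add: right_diff_distrib)
  then show ?thesis
    using vabs_padic_pow[OF u y] vabs_padic_pow_minus_1[OF u valuation_ring_diff[OF x y]]
    by (simp add: vabs_mult)
qed

lemma vabs_qnumber_diff:
  assumes u: "u \<in> exp_units" and x: "x \<in> valuation_ring" and y: "y \<in> valuation_ring"
  shows "vabs (qnumber u x - qnumber u y) = vabs (x - y)"
proof (cases "u = 1")
  case False
  then have "vabs (qnumber u x - qnumber u y) = vabs (padic_pow u y - padic_pow u x) / vabs (1 - u)"
    by (simp add: qnumber_def flip: diff_divide_distrib vabs_divide)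
  then show ?thesis
    using vabs_padic_pow_diff[OF u y x] False
    by (simp add: vabs_minus_commute[of 1] vabs_minus_commute[of y])
qed (simp add: qnumber_def)

lemma qnumber_0: "qnumber u (0::'a) = 0"
  by (simp add: qnumber_def padic_pow_def padic_exp_0)

lemma qnumber_in_valuation_ring:
  assumes "u \<in> exp_units" and "x \<in> valuation_ring"
  shows "qnumber u x \<in> valuation_ring"
  using vabs_qnumber_diff[OF assms valuation_ring_0] assms(2)
  by (simp add: qnumber_0 valuation_ring_def)

lemma qnumber_inverse:
  assumes "u \<in> exp_units"
  shows "qnumber (inverse u) x = - u * qnumber u (- x)"
proof (cases "u = 1")
  case False
  have "u \<noteq> 0"
    by (rule exp_unit_nonzero[OF assms])
  then have "1 - inverse u = - ((1 - u) / u)"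
    by (simp add: field_simps)
  then show ?thesis
    using False \<open>u \<noteq> 0\<close> padic_pow_inverse[OF assms, of x] by (simp add: qnumber_def)
qed (simp add: qnumber_def)

section \<open>The fermionic integral\<close>

text \<open>
  \<open>I\<close> is the integral of \<open>f\<close> against \<open>\<mu>\<^bsub>-1\<^esub>\<close>. It depends only on the values of \<open>f\<close> on \<open>\<int>\<close>, and
  uniform continuity on \<open>\<int>\<close> means that these values extend continuously to \<open>\<int>\<^sub>p\<close>.
\<close>

definition has_fermionic_integral :: "('a \<Rightarrow> 'a) \<Rightarrow> 'a \<Rightarrow> bool" where
  "has_fermionic_integral f I \<longleftrightarrow> (\<lambda>N. alternating_sum f (p ^ N)) \<longlonglongrightarrow> I"

lemma eventually_almost_period:
  fixes f :: "'a \<Rightarrow> 'a"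
  assumes "uniformly_continuous_on \<int> f" and "0 < e"
  shows "\<forall>\<^sub>F N in sequentially. almost_period f e (p ^ N)"
proof -
  obtain d where "0 < d"
    and d: "\<And>x y. x \<in> \<int> \<Longrightarrow> y \<in> \<int> \<Longrightarrow> dist y x < d \<Longrightarrow> dist (f y) (f x) < e"
    using assms unfolding uniformly_continuous_on_def by metis
  have "\<forall>\<^sub>F N in sequentially. vabs (of_nat (p ^ N) :: 'a) < d"
    using order_tendstoD(2)[OF vabs_p_power_tendsto_0 \<open>0 < d\<close>] .
  then show ?thesis
  proof (rule eventually_mono)
    fix N
    assume small: "vabs (of_nat (p ^ N) :: 'a) < d"
    show "almost_period f e (p ^ N)"
      unfolding almost_period_def
    proof
      fix k :: 'a
      assume "k \<in> \<int>"
      then have "dist (f (k + of_nat (p ^ N))) (f k) < e"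
        using small by (intro d) (simp_all add: dist_vabs del: of_nat_power)
      then show "vabs (f (k + of_nat (p ^ N)) - f k) \<le> e"
        by (simp add: dist_vabs)
    qed
  qed
qed

lemma tendsto_0_of_almost_period_bound:
  fixes f :: "'a \<Rightarrow> 'a" and X :: "nat \<Rightarrow> 'a"
  assumes f: "uniformly_continuous_on \<int> f"
    and bound: "\<And>B N. almost_period f B (p ^ N) \<Longrightarrow> vabs (X N) \<le> B"
  shows "X \<longlonglongrightarrow> 0"
proof (rule tendstoI)
  fix e :: real
  assume "0 < e"
  then have "\<forall>\<^sub>F N in sequentially. almost_period f (e / 2) (p ^ N)"
    by (intro eventually_almost_period[OF f]) simp
  then show "\<forall>\<^sub>F N in sequentially. dist (X N) 0 < e"
  proof (rule eventually_mono)
    fix N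
    assume "almost_period f (e / 2) (p ^ N)"
    then show "dist (X N) 0 < e"
      using bound[of "e / 2" N] \<open>0 < e\<close> by (simp add: dist_vabs)
  qed
qed

lemma has_fermionic_integral_exists:
  assumes "odd p" and f: "uniformly_continuous_on \<int> f"
  obtains I where "has_fermionic_integral f I"
proof -
  have "(\<lambda>N. alternating_sum f (p ^ Suc N) - alternating_sum f (p ^ N)) \<longlonglongrightarrow> 0"
    by (rule tendsto_0_of_almost_period_bound[OF f])
      (simp add: vabs_alternating_sum_odd_mult_le \<open>odd p\<close>)
  then have "convergent (\<lambda>N. alternating_sum f (p ^ N))"
    by (rule convergent_ultrametric[OF complete_UNIV])
  then show ?thesis
    using that by (auto simp: convergent_def has_fermionic_integral_def)
qed

lemma has_fermionic_integral_unique: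
  "has_fermionic_integral f I \<Longrightarrow> has_fermionic_integral f J \<Longrightarrow> I = J"
  unfolding has_fermionic_integral_def by (rule LIMSEQ_unique)

lemma has_fermionic_integral_cong:
  assumes "\<And>y. f (of_nat y) = g (of_nat y)"
  shows "has_fermionic_integral f I \<longleftrightarrow> has_fermionic_integral g I"
  by (simp add: has_fermionic_integral_def alternating_sum_cong[of f g, OF assms])

lemma has_fermionic_integral_cmult:
  "has_fermionic_integral f I \<Longrightarrow> has_fermionic_integral (\<lambda>y. c * f y) (c * I)"
  unfolding has_fermionic_integral_def alternating_sum_cmult
  by (intro tendsto_mult tendsto_const)

lemma has_fermionic_integral_reflect:
  assumes "odd p" and f: "uniformly_continuous_on \<int> f" and I: "has_fermionic_integral f I"
  shows "has_fermionic_integral (\<lambda>y. f (- 1 - y)) I"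
proof -
  have "(\<lambda>N. alternating_sum (\<lambda>y. f (- 1 - y)) (p ^ N) - alternating_sum f (p ^ N)) \<longlonglongrightarrow> 0"
    by (rule tendsto_0_of_almost_period_bound[OF f])
      (simp add: vabs_alternating_sum_reflect_le \<open>odd p\<close>)
  from tendsto_add[OF this I[unfolded has_fermionic_integral_def]] show ?thesis
    by (simp add: has_fermionic_integral_def)
qed

lemma has_fermionic_integral_shift:
  assumes "odd p" and f: "uniformly_continuous_on \<int> f" and I: "has_fermionic_integral f I"
  shows "has_fermionic_integral (\<lambda>y. f (y + 1)) (2 * f 0 - I)"
proof -
  have "(\<lambda>N. alternating_sum (\<lambda>y. f (y + 1)) (p ^ N) + alternating_sum f (p ^ N) - 2 * f 0) \<longlonglongrightarrow> 0"
    by (rule tendsto_0_of_almost_period_bound[OF f])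
      (simp add: vabs_alternating_sum_shift_le \<open>odd p\<close>)
  from tendsto_add[OF tendsto_diff[OF this I[unfolded has_fermionic_integral_def]]
      tendsto_const[of "2 * f 0"]]
  show ?thesis
    by (simp add: has_fermionic_integral_def)
qed

lemma fermionic_integral_eq:
  assumes u: "u \<in> exp_units" and g: "has_fermionic_integral g I"
    and density: "\<And>y. g (of_nat y) = f (of_nat y) * u ^ y"
  shows "fermionic_integral p u f = (1 + u) / 2 * I"
proof -
  have "(\<lambda>N. (1 + u) * inverse (1 + u ^ p ^ N) * alternating_sum g (p ^ N))
      \<longlonglongrightarrow> (1 + u) * inverse (1 + 1) * I"
    using g unfolding has_fermionic_integral_def
    by (intro tendsto_mult tendsto_add tendsto_const tendsto_inverse_ultrametric
        exp_unit_power_p_power_tendsto_1 u) simp_all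
  moreover have "alternating_sum g n = (\<Sum>y<n. f (of_nat y) * (-1) ^ y * u ^ y)" for n
    by (simp add: alternating_sum_def density mult_ac)
  ultimately have "(\<lambda>N. (1 + u) / (1 + u ^ p ^ N) * (\<Sum>y<p ^ N. f (of_nat y) * (-1) ^ y * u ^ y))
      \<longlonglongrightarrow> (1 + u) / 2 * I"
    by (simp only: divide_inverse one_add_one)
  then show ?thesis
    unfolding fermionic_integral_def by (rule limI)
qed

section \<open>The \<open>q\<close>-Euler numbers\<close>

text \<open>The integrand of \<open>E\<^bsub>m,u\<^esub>\<^bsup>(h,1)\<^esup>(x)\<close> times the density \<open>u\<^sup>y\<close> of \<open>\<mu>\<^bsub>-u\<^esub>\<close>.\<close>

definition qeuler_weight :: "int \<Rightarrow> nat \<Rightarrow> 'a \<Rightarrow> 'a \<Rightarrow> 'a \<Rightarrow> 'a" where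
  "qeuler_weight h m u x y = qnumber u (x + y) ^ m * padic_pow u (of_int h * y)"

lemma lipschitz_on_qeuler_weight:
  assumes u: "u \<in> exp_units" and x: "x \<in> valuation_ring"
  shows "1-lipschitz_on valuation_ring (qeuler_weight h m u x)"
proof -
  have "1-lipschitz_on valuation_ring (\<lambda>y. qnumber u (x + y))"
    using vabs_qnumber_diff[OF u] x
    by (intro lipschitz_onI) (simp_all add: dist_vabs valuation_ring_add)
  moreover have "(\<lambda>y. qnumber u (x + y)) ` valuation_ring \<subseteq> valuation_ring"
    using x by (auto intro: qnumber_in_valuation_ring[OF u] valuation_ring_add)
  moreover have "1-lipschitz_on valuation_ring (\<lambda>y. padic_pow u (of_int h * y))"
  proof (rule lipschitz_onI)
    fix y z :: 'a
    assume yz: "y \<in> valuation_ring" "z \<in> valuation_ring"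
    have "dist (padic_pow u (of_int h * y)) (padic_pow u (of_int h * z))
        = vabs (of_int h * (y - z)) * vabs (u - 1)"
      using vabs_padic_pow_diff[OF u] yz
      by (simp add: dist_vabs valuation_ring_mult right_diff_distrib)
    also have "\<dots> \<le> vabs (y - z) * 1"
      using u radius_less_1 by (intro mult_mono vabs_of_int_mult_le) (simp_all add: exp_units_def)
    finally show "dist (padic_pow u (of_int h * y)) (padic_pow u (of_int h * z)) \<le> 1 * dist y z"
      by (simp add: dist_vabs)
  qed simp
  moreover have "(\<lambda>y. padic_pow u (of_int h * y)) ` valuation_ring \<subseteq> valuation_ring"
    using vabs_padic_pow[OF u valuation_ring_mult[OF valuation_ring_of_int]]
    by (auto simp: valuation_ring_def)
  ultimately show ?thesis
    unfolding qeuler_weight_def[abs_def]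
    by (intro lipschitz_on_mult_ultrametric lipschitz_on_power_ultrametric)
      (auto intro: valuation_ring_power)
qed

lemma uniformly_continuous_on_qeuler_weight:
  assumes "u \<in> exp_units" and "x \<in> valuation_ring"
  shows "uniformly_continuous_on \<int> (qeuler_weight h m u x)"
  by (rule lipschitz_on_uniformly_continuous[OF
        lipschitz_on_subset[OF lipschitz_on_qeuler_weight[OF assms] Ints_subset_valuation_ring]])

lemma qeuler_eq:
  assumes u: "u \<in> exp_units" and I: "has_fermionic_integral (qeuler_weight h m u x) I"
  shows "qeuler p h m u x = (1 + u) / 2 * I"
  unfolding qeuler_def
proof (rule fermionic_integral_eq[OF u I])
  fix y
  have "of_int h * of_nat y = (of_int (h - 1) * of_nat y + of_nat y :: 'a)"
    by (simp add: algebra_simps)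
  then have "padic_pow u (of_int h * of_nat y) = padic_pow u (of_int (h - 1) * of_nat y) * u ^ y"
    by (simp only: padic_pow_add[OF u] padic_pow_of_nat[OF u] valuation_ring_mult
        valuation_ring_of_int valuation_ring_of_nat)
  then show "qeuler_weight h m u x (of_nat y)
      = qnumber u (x + of_nat y) ^ m * padic_pow u (of_int (h - 1) * of_nat y) * u ^ y"
    by (simp add: qeuler_weight_def)
qed

lemma qeuler_weight_inverse:
  assumes u: "u \<in> exp_units" and y: "y \<in> valuation_ring"
  shows "qeuler_weight h m (inverse u) (1 - x) y
    = (- u) ^ m * u powi h * qeuler_weight h m u x (- 1 - y)"
proof -
  have "qnumber (inverse u) (1 - x + y) = - u * qnumber u (x + (- 1 - y))"
    using qnumber_inverse[OF u, of "1 - x + y"] by (simp add: algebra_simps)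
  moreover have "padic_pow (inverse u) (of_int h * y)
      = u powi h * padic_pow u (of_int h * (- 1 - y))"
  proof -
    have "padic_pow (inverse u) (of_int h * y) = padic_pow u (of_int h + of_int h * (- 1 - y))"
      using padic_pow_inverse[OF u] by (simp add: algebra_simps)
    also have "\<dots> = padic_pow u (of_int h) * padic_pow u (of_int h * (- 1 - y))"
      using valuation_ring_diff[OF valuation_ring_of_int[of "-1"] y]
      by (intro padic_pow_add u valuation_ring_of_int valuation_ring_mult) simp
    finally show ?thesis
      by (simp only: padic_pow_of_int[OF u])
  qed
  ultimately show ?thesis
    by (simp only: qeuler_weight_def power_mult_distrib mult_ac)
qed

lemma qeuler_weight_0_Suc:
  assumes u: "u \<in> exp_units" and y: "y \<in> valuation_ring"
  shows "qeuler_weight h m u 0 (y + 1) = u powi h * qeuler_weight h m u 1 y"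
  using padic_pow_add[OF u valuation_ring_of_int[of h]
      valuation_ring_mult[OF valuation_ring_of_int[of h] y]]
  by (simp add: qeuler_weight_def padic_pow_of_int[OF u] algebra_simps)

lemma qeuler_reflection:
  assumes "odd p" and u: "u \<in> exp_units" and x: "x \<in> valuation_ring"
  shows "qeuler p h m (inverse u) (1 - x) = (-1) ^ m * u powi (int m + h - 1) * qeuler p h m u x"
proof -
  define c where "c = (- u) ^ m * u powi h"
  note continuous = uniformly_continuous_on_qeuler_weight[OF u x, of h m]
  obtain I where I: "has_fermionic_integral (qeuler_weight h m u x) I"
    using has_fermionic_integral_exists[OF \<open>odd p\<close> continuous] .
  have "has_fermionic_integral (\<lambda>y. c * qeuler_weight h m u x (- 1 - y)) (c * I)"
    by (intro has_fermionic_integral_cmult has_fermionic_integral_reflect \<open>odd p\<close> continuous I)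
  then have "has_fermionic_integral (qeuler_weight h m (inverse u) (1 - x)) (c * I)"
    by (subst has_fermionic_integral_cong) (simp_all add: c_def qeuler_weight_inverse[OF u])
  then have "qeuler p h m (inverse u) (1 - x) = (1 + inverse u) / 2 * (c * I)"
    by (rule qeuler_eq[OF exp_units_inverse[OF u]])
  also have "\<dots> = c / u * ((1 + u) / 2 * I)"
    using exp_unit_nonzero[OF u] by (simp add: field_simps)
  also have "c / u = (-1) ^ m * u powi (int m + h - 1)"
    using exp_unit_nonzero[OF u]
    by (simp add: c_def power_int_add power_int_diff power_minus[of u])
  finally show ?thesis
    by (simp only: qeuler_eq[OF u I])
qed

lemma qeuler_1:
  assumes "odd p" and u: "u \<in> exp_units" and "0 < m"
  shows "u powi h * qeuler p h m u 1 = - qeuler p h m u 0"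
proof -
  note continuous = uniformly_continuous_on_qeuler_weight[OF u]
  obtain I where I: "has_fermionic_integral (qeuler_weight h m u 0) I"
    using has_fermionic_integral_exists[OF \<open>odd p\<close> continuous[OF valuation_ring_0]] .
  obtain J where J: "has_fermionic_integral (qeuler_weight h m u 1) J"
    using has_fermionic_integral_exists[OF \<open>odd p\<close> continuous[OF valuation_ring_1]] .
  have "qeuler_weight h m u 0 0 = 0"
    using \<open>0 < m\<close> by (simp add: qeuler_weight_def qnumber_0)
  then have "has_fermionic_integral (\<lambda>y. qeuler_weight h m u 0 (y + 1)) (- I)"
    using has_fermionic_integral_shift[OF \<open>odd p\<close> continuous[OF valuation_ring_0] I] by simp
  moreover have "has_fermionic_integral (\<lambda>y. qeuler_weight h m u 0 (y + 1)) (u powi h * J)"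
    using has_fermionic_integral_cmult[OF J, of "u powi h"]
    by (subst has_fermionic_integral_cong) (simp_all add: qeuler_weight_0_Suc[OF u])
  ultimately have "u powi h * J = - I"
    by (rule has_fermionic_integral_unique[rotated])
  then show ?thesis
    by (simp add: qeuler_eq[OF u I] qeuler_eq[OF u J] mult.left_commute)
qed

end

theorem theorem4:
  fixes p m :: nat and h :: int and q :: "'a::ultrametric_field"
  assumes "prime p" and "odd p"
    and "is_padic_complex_field p TYPE('a)"
    and "vabs (1 - q) < real p powr (- 1 / (real p - 1))"
    and "m \<ge> 1"
  shows "(\<forall>x \<in> padic_integers.
            qeuler p h m (inverse q) (1 - x) =
              (-1) ^ m * q powi (int m + h - 1) * qeuler p h m q x) \<and>
         qeuler p h m (inverse q) 0 =
           (-1) ^ m * q powi (int m + h - 1) * qeuler p h m q 1 \<and>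
         (-1) ^ m * q powi (int m + h - 1) * qeuler p h m q 1 =
           (-1) ^ (m - 1) * q ^ (m - 1) * qeuler p h m q 0"
proof -
  interpret padic_field p "TYPE('a)"
    using assms(1,3) by unfold_locales (simp_all add: is_padic_complex_field_def)
  have q: "q \<in> exp_units"
    using assms(4) by (simp add: exp_units_def radius_def vabs_minus_commute)
  have "int m + h - 1 = int (m - 1) + h"
    using assms(5) by simp
  then have "q powi (int m + h - 1) = q ^ (m - 1) * q powi h"
    using exp_unit_nonzero[OF q] by (metis power_int_add power_int_of_nat)
  moreover have "(-1) ^ m = - ((-1) ^ (m - 1) :: 'a)"
    using assms(5) by (simp add: power_eq_if)
  ultimately have "(-1) ^ m * q powi (int m + h - 1) * qeuler p h m q 1
      = (-1) ^ (m - 1) * q ^ (m - 1) * qeuler p h m q 0"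
    using qeuler_1[OF assms(2) q, of m h] assms(5) by (simp add: mult.assoc)
  moreover have "padic_integers \<subseteq> (valuation_ring :: 'a set)"
    by (auto simp: padic_integers_def valuation_ring_def)
  ultimately show ?thesis
    using qeuler_reflection[OF assms(2) q, of _ h m]
      qeuler_reflection[OF assms(2) q valuation_ring_1, of h m]
    by auto
qed

end
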